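(* Let $(\mathbf{X},\mathbf{T})$ be a nonautonomous dynamical system and let $K\subset X_0$ be non-empty and compact. Then $$h_{\mathrm{top}}^{\mathrm{B}}(\mathbf{T},K)=\sup\{\underline{h}_{\mu}(\mathbf{T}):\mu\in M(X_0),\ \mu(K)=1\}.$$
   Context: A nonautonomous dynamical system (NDS) $(\mathbf{X},\mathbf{T})$ consists of a sequence $\mathbf{X}=\{X_k\}_{k=0}^\infty$ of compact metric spaces $(X_k,d_k)$ and a sequence $\mathbf{T}=\{T_k\}_{k=0}^\infty$ of continuous maps $T_k:X_k\to X_{k+1}$. Put $\mathbf{T}^0=\mathrm{id}_{X_0}$ and $\mathbf{T}^j=T_{j-1}\circ\cdots\circ T_0:X_0\to X_j$. For $n\ge1$ and $x,y\in X_0$ let $d_n^{\mathbf{T}}(x,y)=\max_{0\le j\le n-1}d_j(\mathbf{T}^jx,\mathbf{T}^jy)$, and for $\varepsilon>0$ let $B_n^{\mathbf{T}}(x,\varepsilon)=\{y\in X_0:d_n^{\mathbf{T}}(x,y)<\varepsilon\}$ (Bowen ball). $M(X_0)$ is the set of Borel probability measures on $X_0$. Measure-theoretic lower entropy: $\underline{h}_\mu(\mathbf{T})=\int_{X_0}\underline{h}_\mu(\mathbf{T},x)\,d\mu(x)$, where $\underline{h}_\mu(\mathbf{T},x)=\lim_{\varepsilon\to0}\liminf_{n\to\infty}\frac{-\log\mu(B_n^{\mathbf{T}}(x,\varepsilon))}{n}$, with $\log0=-\infty$. Bowen entropy: for $Z\subset X_0$, an $(N,\varepsilon)$-cover of $Z$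 is a family $\{B_{n_i}^{\mathbf{T}}(x_i,\varepsilon)\}_i$ with $x_i\in X_0$ and integers $n_i\ge N$ whose union contains $Z$. For $s\in\mathbb{R}$, $N,\varepsilon>0$ let $\mathscr{R}_{N,\varepsilon}^{s}(\mathbf{T},\mathbf{0},Z)=\inf\sum_i\exp(-n_is)$ over all countable (finite or infinite) $(N,\varepsilon)$-covers of $Z$; $\mathscr{R}_{\varepsilon}^{s}(\mathbf{T},\mathbf{0},Z)=\lim_{N\to\infty}\mathscr{R}_{N,\varepsilon}^{s}(\mathbf{T},\mathbf{0},Z)$; $h_{\mathrm{top}}^{\mathrm{B}}(\mathbf{T},Z)=\lim_{\varepsilon\to0}\inf\{s:\mathscr{R}_{\varepsilon}^{s}(\mathbf{T},\mathbf{0},Z)=0\}$ (monotone limit). *)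

theory Defs
  imports "HOL-Probability.Probability"
begin

text \<open>
  All phase spaces are carriers \<open>X k\<close>, with metrics \<open>d k\<close>, inside one ambient type \<open>'a\<close>.
  As \<open>'a\<close> is arbitrary this loses no generality: any sequence of spaces embeds in its disjoint
  union.
\<close>

locale nds =
  fixes X :: "nat \<Rightarrow> 'a set" and d :: "nat \<Rightarrow> 'a \<Rightarrow> 'a \<Rightarrow> real" and T :: "nat \<Rightarrow> 'a \<Rightarrow> 'a"
  assumes metric: "Metric_space (X k) (d k)"
    and compact: "compact_space (Metric_space.mtopology (X k) (d k))"
    and continuous: "continuous_map (Metric_space.mtopology (X k) (d k))
                       (Metric_space.mtopology (X (Suc k)) (d (Suc k))) (T k)"

primrec iter :: "(nat \<Rightarrow> 'a \<Rightarrow> 'a) \<Rightarrow> nat \<Rightarrow> 'a \<Rightarrow> 'a" where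
  "iter T 0 = id"
| "iter T (Suc j) = T j \<circ> iter T j"

text \<open>The maximum is taken over the empty set, hence unspecified, for \<open>n = 0\<close>. This value affects
  none of the entropies below, which only see it before the limit in \<open>n\<close> or \<open>N\<close> is taken.\<close>

definition bowen_dist ::
  "(nat \<Rightarrow> 'a \<Rightarrow> 'a \<Rightarrow> real) \<Rightarrow> (nat \<Rightarrow> 'a \<Rightarrow> 'a) \<Rightarrow> nat \<Rightarrow> 'a \<Rightarrow> 'a \<Rightarrow> real" where
  "bowen_dist d T n x y = Max ((\<lambda>j. d j (iter T j x) (iter T j y)) ` {..<n})"

definition bowen_ball ::
  "(nat \<Rightarrow> 'a set) \<Rightarrow> (nat \<Rightarrow> 'a \<Rightarrow> 'a \<Rightarrow> real) \<Rightarrow> (nat \<Rightarrow> 'a \<Rightarrow> 'a) \<Rightarrow> nat \<Rightarrow> 'a \<Rightarrow> real \<Rightarrow> 'a set" where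
  "bowen_ball X d T n x \<epsilon> = {y \<in> X 0. bowen_dist d T n x y < \<epsilon>}"

definition borel_prob_measures :: "'a topology \<Rightarrow> 'a measure set" where
  "borel_prob_measures U =
     {\<mu>. prob_space \<mu> \<and> space \<mu> = topspace U \<and> sets \<mu> = sigma_sets (topspace U) {S. openin U S}}"

definition ereal_log :: "real \<Rightarrow> ereal" where
  "ereal_log p = (if p = 0 then -\<infinity> else ereal (ln p))"

definition local_lower_entropy_at ::
  "(nat \<Rightarrow> 'a set) \<Rightarrow> (nat \<Rightarrow> 'a \<Rightarrow> 'a \<Rightarrow> real) \<Rightarrow> (nat \<Rightarrow> 'a \<Rightarrow> 'a) \<Rightarrow> 'a measure \<Rightarrow> 'a \<Rightarrow> real \<Rightarrow> ereal" where
  "local_lower_entropy_at X d T \<mu> x \<epsilon> =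
     liminf (\<lambda>n. (- ereal_log (measure \<mu> (bowen_ball X d T n x \<epsilon>))) / ereal (real n))"

definition local_lower_entropy ::
  "(nat \<Rightarrow> 'a set) \<Rightarrow> (nat \<Rightarrow> 'a \<Rightarrow> 'a \<Rightarrow> real) \<Rightarrow> (nat \<Rightarrow> 'a \<Rightarrow> 'a) \<Rightarrow> 'a measure \<Rightarrow> 'a \<Rightarrow> ereal" where
  "local_lower_entropy X d T \<mu> x = Lim (at_right 0) (local_lower_entropy_at X d T \<mu> x)"

text \<open>For a probability measure the local entropies lie in \<open>[0, \<infinity>]\<close>, so that the coercion to
  \<open>ennreal\<close> loses nothing.\<close>

definition lower_entropy ::
  "(nat \<Rightarrow> 'a set) \<Rightarrow> (nat \<Rightarrow> 'a \<Rightarrow> 'a \<Rightarrow> real) \<Rightarrow> (nat \<Rightarrow> 'a \<Rightarrow> 'a) \<Rightarrow> 'a measure \<Rightarrow> ereal" where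
  "lower_entropy X d T \<mu> =
     enn2ereal (\<integral>\<^sup>+ x. e2ennreal (local_lower_entropy X d T \<mu> x) \<partial>\<mu>)"

text \<open>A countable cover is indexed by a finite or infinite set \<open>I\<close> of naturals, the member with
  index \<open>i\<close> being the Bowen ball of order \<open>m i\<close> around \<open>c i\<close>.\<close>

definition bowen_cover ::
  "(nat \<Rightarrow> 'a set) \<Rightarrow> (nat \<Rightarrow> 'a \<Rightarrow> 'a \<Rightarrow> real) \<Rightarrow> (nat \<Rightarrow> 'a \<Rightarrow> 'a) \<Rightarrow> nat \<Rightarrow> real \<Rightarrow> 'a set
     \<Rightarrow> nat set \<Rightarrow> (nat \<Rightarrow> 'a) \<Rightarrow> (nat \<Rightarrow> nat) \<Rightarrow> bool" where
  "bowen_cover X d T N \<epsilon> Z I c m \<longleftrightarrow>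
     (\<forall>i\<in>I. c i \<in> X 0 \<and> N \<le> m i) \<and> Z \<subseteq> (\<Union>i\<in>I. bowen_ball X d T (m i) (c i) \<epsilon>)"

definition bowen_outer_at ::
  "(nat \<Rightarrow> 'a set) \<Rightarrow> (nat \<Rightarrow> 'a \<Rightarrow> 'a \<Rightarrow> real) \<Rightarrow> (nat \<Rightarrow> 'a \<Rightarrow> 'a) \<Rightarrow> 'a set \<Rightarrow> real \<Rightarrow> real \<Rightarrow> nat
     \<Rightarrow> ennreal" where
  "bowen_outer_at X d T Z s \<epsilon> N =
     Inf {(\<Sum>\<^sub>\<infinity>i\<in>I. ennreal (exp (- (real (m i) * s)))) | I c m. bowen_cover X d T N \<epsilon> Z I c m}"

definition bowen_outer ::
  "(nat \<Rightarrow> 'a set) \<Rightarrow> (nat \<Rightarrow> 'a \<Rightarrow> 'a \<Rightarrow> real) \<Rightarrow> (nat \<Rightarrow> 'a \<Rightarrow> 'a) \<Rightarrow> 'a set \<Rightarrow> real \<Rightarrow> real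
     \<Rightarrow> ennreal" where
  "bowen_outer X d T Z s \<epsilon> = lim (bowen_outer_at X d T Z s \<epsilon>)"

definition bowen_entropy_at ::
  "(nat \<Rightarrow> 'a set) \<Rightarrow> (nat \<Rightarrow> 'a \<Rightarrow> 'a \<Rightarrow> real) \<Rightarrow> (nat \<Rightarrow> 'a \<Rightarrow> 'a) \<Rightarrow> 'a set \<Rightarrow> real \<Rightarrow> ereal" where
  "bowen_entropy_at X d T Z \<epsilon> = Inf {ereal s | s. bowen_outer X d T Z s \<epsilon> = 0}"

definition bowen_entropy ::
  "(nat \<Rightarrow> 'a set) \<Rightarrow> (nat \<Rightarrow> 'a \<Rightarrow> 'a \<Rightarrow> real) \<Rightarrow> (nat \<Rightarrow> 'a \<Rightarrow> 'a) \<Rightarrow> 'a set \<Rightarrow> ereal" where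
  "bowen_entropy X d T Z = Lim (at_right 0) (bowen_entropy_at X d T Z)"

text \<open>The operators \<open>lim\<close> and \<open>Lim\<close> are meaningful only for convergent arguments. The remaining
  lemmas show that all three limits above exist, by monotonicity.\<close>

lemma antimono_tendsto_at_right_0:
  fixes f :: "real \<Rightarrow> ereal"
  assumes "\<And>a b. 0 < a \<Longrightarrow> a \<le> b \<Longrightarrow> f b \<le> f a"
  shows "(f \<longlongrightarrow> (SUP e\<in>{0<..}. f e)) (at_right 0)"
proof (rule order_tendstoI)
  fix a assume "a < (SUP e\<in>{0<..}. f e)"
  then obtain e where e: "0 < e" "a < f e"
    by (auto simp: less_SUP_iff)
  have "\<forall>\<^sub>F x in at_right 0. x \<in> {0<..<e}"
    using e(1) by (rule eventually_at_right_real)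
  then show "\<forall>\<^sub>F x in at_right 0. a < f x"
  proof (rule eventually_mono)
    fix x assume "x \<in> {0<..<e}"
    then have "f e \<le> f x" by (intro assms) auto
    with e(2) show "a < f x" by (rule less_le_trans)
  qed
next
  fix a assume a: "(SUP e\<in>{0<..}. f e) < a"
  have "\<forall>\<^sub>F x in at_right (0::real). x \<in> {0<..<1}"
    by (rule eventually_at_right_real) simp
  then show "\<forall>\<^sub>F x in at_right 0. f x < a"
  proof (rule eventually_mono)
    fix x :: real assume "x \<in> {0<..<1}"
    then have "f x \<le> (SUP e\<in>{0<..}. f e)" by (intro SUP_upper) simp
    then show "f x < a" using a by (rule le_less_trans)
  qed
qed

lemma bowen_ball_mono: "a \<le> b \<Longrightarrow> bowen_ball X d T n x a \<subseteq> bowen_ball X d T n x b"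
  by (auto simp: bowen_ball_def)

lemma bowen_outer_at_incseq: "incseq (bowen_outer_at X d T Z s \<epsilon>)"
proof (rule monoI)
  fix M N :: nat assume "M \<le> N"
  then have "bowen_cover X d T M \<epsilon> Z I c m" if "bowen_cover X d T N \<epsilon> Z I c m" for I c m
    using that by (auto simp: bowen_cover_def)
  then show "bowen_outer_at X d T Z s \<epsilon> M \<le> bowen_outer_at X d T Z s \<epsilon> N"
    unfolding bowen_outer_at_def by (intro Inf_superset_mono) blast
qed

lemma bowen_outer_eq_SUP: "bowen_outer X d T Z s \<epsilon> = (SUP N. bowen_outer_at X d T Z s \<epsilon> N)"
  unfolding bowen_outer_def by (intro limI LIMSEQ_SUP bowen_outer_at_incseq)

lemma bowen_outer_antimono:
  assumes "a \<le> b"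
  shows "bowen_outer X d T Z s b \<le> bowen_outer X d T Z s a"
proof -
  have "bowen_cover X d T N b Z I c m" if "bowen_cover X d T N a Z I c m" for N I c m
  proof -
    have "(\<Union>i\<in>I. bowen_ball X d T (m i) (c i) a) \<subseteq> (\<Union>i\<in>I. bowen_ball X d T (m i) (c i) b)"
      by (intro UN_mono subset_refl bowen_ball_mono assms)
    with that show ?thesis
      unfolding bowen_cover_def by (blast intro: subset_trans)
  qed
  then have "bowen_outer_at X d T Z s b N \<le> bowen_outer_at X d T Z s a N" for N
    unfolding bowen_outer_at_def by (intro Inf_superset_mono) blast
  then show ?thesis
    unfolding bowen_outer_eq_SUP by (intro SUP_mono) blast
qed

lemma bowen_entropy_tendsto:
  "(bowen_entropy_at X d T Z \<longlongrightarrow> bowen_entropy X d T Z) (at_right 0)"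
proof -
  have "bowen_entropy_at X d T Z b \<le> bowen_entropy_at X d T Z a" if "a \<le> b" for a b
    unfolding bowen_entropy_at_def
  proof (rule Inf_superset_mono, clarify)
    fix s assume "bowen_outer X d T Z s a = 0"
    with bowen_outer_antimono[OF that, of X d T Z s] have "bowen_outer X d T Z s b = 0" by simp
    then show "\<exists>r. ereal s = ereal r \<and> bowen_outer X d T Z r b = 0" by blast
  qed
  then have "(bowen_entropy_at X d T Z \<longlongrightarrow> (SUP e\<in>{0<..}. bowen_entropy_at X d T Z e)) (at_right 0)"
    by (intro antimono_tendsto_at_right_0)
  then show ?thesis
    unfolding bowen_entropy_def by (simp add: tendsto_Lim)
qed

context nds
begin

lemma iter_continuous:
  "continuous_map (Metric_space.mtopology (X 0) (d 0)) (Metric_space.mtopology (X j) (d j)) (iter T j)"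
proof (induction j)
  case 0
  show ?case by (simp only: iter.simps) simp
next
  case (Suc j)
  show ?case
    unfolding iter.simps by (rule continuous_map_compose[OF Suc continuous])
qed

lemma bowen_ball_openin:
  assumes "x \<in> X 0" "0 < n"
  shows "openin (Metric_space.mtopology (X 0) (d 0)) (bowen_ball X d T n x \<epsilon>)"
proof -
  have top: "topspace (Metric_space.mtopology (X j) (d j)) = X j" for j
    by (rule Metric_space.topspace_mtopology[OF metric])
  have im: "iter T j y \<in> X j" if "y \<in> X 0" for j y
    using continuous_map_image_subset_topspace[OF iter_continuous[of j]] that unfolding top by blast
  have eq: "bowen_ball X d T n x \<epsilon> =
      (\<Inter>j\<in>{..<n}. {y \<in> topspace (Metric_space.mtopology (X 0) (d 0)).
                    iter T j y \<in> Metric_space.mball (X j) (d j) (iter T j x) \<epsilon>})"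
  proof -
    have "bowen_dist d T n x y < \<epsilon> \<longleftrightarrow> (\<forall>j\<in>{..<n}. d j (iter T j x) (iter T j y) < \<epsilon>)" for y
      unfolding bowen_dist_def using assms(2) by (subst Max_less_iff) auto
    then show ?thesis
      unfolding bowen_ball_def top Metric_space.in_mball[OF metric]
      using im assms by (intro set_eqI) (simp, blast)
  qed
  show ?thesis
    unfolding eq using assms(2)
    by (intro openin_INT2 openin_continuous_map_preimage[OF iter_continuous]
        Metric_space.openin_mball[OF metric]) auto
qed

lemma local_lower_entropy_tendsto:
  assumes \<mu>: "\<mu> \<in> borel_prob_measures (Metric_space.mtopology (X 0) (d 0))" and x: "x \<in> X 0"
  shows "(local_lower_entropy_at X d T \<mu> x \<longlongrightarrow> local_lower_entropy X d T \<mu> x) (at_right 0)"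
proof -
  interpret \<mu>: prob_space \<mu>
    using \<mu> by (simp add: borel_prob_measures_def)
  have *: "local_lower_entropy_at X d T \<mu> x b \<le> local_lower_entropy_at X d T \<mu> x a" if "a \<le> b" for a b
    unfolding local_lower_entropy_at_def
  proof (intro Liminf_mono eventually_mono[OF eventually_gt_at_top[of 0]])
    fix n :: nat assume n: "0 < n"
    have "bowen_ball X d T n x b \<in> sets \<mu>"
      using \<mu> bowen_ball_openin[OF x n] by (auto simp: borel_prob_measures_def)
    then have le: "measure \<mu> (bowen_ball X d T n x a) \<le> measure \<mu> (bowen_ball X d T n x b)"
      by (intro \<mu>.finite_measure_mono bowen_ball_mono that)
    have "ereal_log p \<le> ereal_log q" if "0 \<le> p" "p \<le> q" for p q
      using that by (auto simp: ereal_log_def)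
    with le show "- ereal_log (measure \<mu> (bowen_ball X d T n x b)) / ereal (real n)
        \<le> - ereal_log (measure \<mu> (bowen_ball X d T n x a)) / ereal (real n)"
      using n by (intro ereal_divide_right_mono) (auto simp: ereal_minus_le_minus)
  qed
  then have "(local_lower_entropy_at X d T \<mu> x \<longlongrightarrow>
      (SUP e\<in>{0<..}. local_lower_entropy_at X d T \<mu> x e)) (at_right 0)"
    by (intro antimono_tendsto_at_right_0)
  then show ?thesis
    unfolding local_lower_entropy_def by (simp add: tendsto_Lim)
qed

end

end

theory Submission
  imports Defs
begin

text \<open>
  If the Bowen entropy at some scale is below \<open>s\<close>, then \<open>K\<close> has covers by Bowen balls of arbitrarily
  small total weight; the balls of measure less than \<open>exp (- n s)\<close> among them show that the points
  all of whose later Bowen balls are that small form a null set, so local entropies are at most \<open>s\<close>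
  almost everywhere.

  Conversely, a Frostman measure is needed: \<open>\<mu> (B n x \<epsilon>) \<le> C exp (- n s)\<close> for all large \<open>n\<close>. For
  orders up to \<open>M\<close>, put weights on a finite net of \<open>K\<close> and raise them until every point of the net
  lies in a saturated ball. As the Bowen metrics increase with \<open>n\<close>, two intersecting balls of orders
  \<open>n \<le> m\<close> satisfy \<open>B m y \<epsilon> \<subseteq> B n x (3 \<epsilon>)\<close>, so a Vitali selection that prefers small orders
  gives disjoint saturated balls whose enlargements cover \<open>K\<close>. Hence the total weight is bounded below
  by the Bowen outer measure of \<open>K\<close>, independently of \<open>M\<close>; no duality argument is needed because the
  gauge \<open>exp (- n s)\<close> does not change when the radius does. A cluster point of the normalised weights,
  among the functions on all subsets, is finitely additive and satisfies all the bounds. Its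
  regularisation from inside by closed sets and from outside by open sets is an outer measure for
  which open sets are Caratheodory measurable, and it does not exceed the charge on open sets,
  in particular on Bowen balls.
\<close>

section \<open>Borel measures from finitely additive charges\<close>

text \<open>Restricting to closed subsets is what brings compactness in: \<open>l\<close> itself is
  only finitely additive, and countable subadditivity is gained by this regularisation.\<close>

definition inner_charge :: "'a topology \<Rightarrow> ('a set \<Rightarrow> ennreal) \<Rightarrow> 'a set \<Rightarrow> ennreal" where
  "inner_charge U l V = (SUP C\<in>{C. closedin U C \<and> C \<subseteq> V}. l C)"

definition outer_charge :: "'a topology \<Rightarrow> ('a set \<Rightarrow> ennreal) \<Rightarrow> 'a set \<Rightarrow> ennreal" where
  "outer_charge U l A = (INF V\<in>{V. openin U V \<and> A \<subseteq> V}. inner_charge U l V)"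

locale compact_charge =
  fixes U :: "'a topology" and l :: "'a set \<Rightarrow> ennreal"
  assumes compact: "compact_space U" and Hausdorff: "Hausdorff_space U"
    and charge_empty: "l {} = 0"
    and charge_Un: "A \<inter> B = {} \<Longrightarrow> l (A \<union> B) = l A + l B"
begin

lemma charge_mono: "A \<subseteq> B \<Longrightarrow> l A \<le> l B"
  using charge_Un[of A "B - A"] by (simp add: Un_absorb1)

lemma charge_UN_le: "finite I \<Longrightarrow> l (\<Union>i\<in>I. A i) \<le> (\<Sum>i\<in>I. l (A i))"
proof (induction I rule: finite_induct)
  case (insert i I)
  have "l (A i \<union> (\<Union>i\<in>I. A i)) = l (A i) + l ((\<Union>i\<in>I. A i) - A i)"
    using charge_Un[of "A i" "(\<Union>i\<in>I. A i) - A i"] by simp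
  also have "\<dots> \<le> l (A i) + l (\<Union>i\<in>I. A i)"
    by (intro add_left_mono charge_mono) auto
  also have "\<dots> \<le> l (A i) + (\<Sum>i\<in>I. l (A i))"
    by (intro add_left_mono insert.IH)
  finally show ?case using insert.hyps by simp
qed (simp add: charge_empty)

lemma inner_charge_upper: "closedin U C \<Longrightarrow> C \<subseteq> V \<Longrightarrow> l C \<le> inner_charge U l V"
  unfolding inner_charge_def by (rule SUP_upper) simp

lemma inner_charge_mono: "V \<subseteq> W \<Longrightarrow> inner_charge U l V \<le> inner_charge U l W"
  unfolding inner_charge_def by (rule SUP_subset_mono) auto

lemma inner_charge_le: "inner_charge U l V \<le> l V"
  unfolding inner_charge_def by (rule SUP_least) (auto intro: charge_mono)

lemma outer_charge_lower: "openin U V \<Longrightarrow> A \<subseteq> V \<Longrightarrow> outer_charge U l A \<le> inner_charge U l V"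
  unfolding outer_charge_def by (rule INF_lower) simp

lemma outer_charge_openin:
  assumes "openin U V" shows "outer_charge U l V = inner_charge U l V"
  using outer_charge_lower[OF assms order_refl]
  by (rule antisym) (auto simp: outer_charge_def intro!: INF_greatest inner_charge_mono)

lemma outer_charge_mono: "A \<subseteq> B \<Longrightarrow> outer_charge U l A \<le> outer_charge U l B"
  unfolding outer_charge_def by (rule INF_superset_mono) auto

lemma outer_charge_empty: "outer_charge U l {} = 0"
  using outer_charge_lower[of "{}" "{}"] inner_charge_le[of "{}"] by (simp add: charge_empty)

text \<open>A closed set inside the union is compact, so regularity of the space covers it by
  finitely many closed sets, each inside one \<open>V i\<close>; finite subadditivity of the charge
  then suffices.\<close>

lemma inner_charge_UN_le:
  fixes V :: "nat \<Rightarrow> 'a set"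
  assumes V: "\<And>i. openin U (V i)"
  shows "inner_charge U l (\<Union>i. V i) \<le> (\<Sum>i. inner_charge U l (V i))"
  unfolding inner_charge_def[of U l "\<Union>i. V i"]
proof (rule SUP_least, clarify)
  fix C assume C: "closedin U C" "C \<subseteq> (\<Union>i. V i)"
  have reg: "neighbourhood_base_of (closedin U) U"
    using compact Hausdorff by (simp add: neighbourhood_base_of_closedin compact_Hausdorff_imp_regular_space)
  have "\<exists>i W D. openin U W \<and> closedin U D \<and> x \<in> W \<and> W \<subseteq> D \<and> D \<subseteq> V i" if x: "x \<in> C" for x
  proof -
    obtain i where "x \<in> V i" using C x by blast
    then show ?thesis using reg[unfolded neighbourhood_base_of, rule_format, of "V i" x] V[of i] by blast
  qed
  then have "\<forall>x. \<exists>i W D. x \<in> C \<longrightarrow> openin U W \<and> closedin U D \<and> x \<in> W \<and> W \<subseteq> D \<and> D \<subseteq> V i"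
    by auto
  from this[unfolded choice_iff] obtain i W D where
    "\<forall>x. x \<in> C \<longrightarrow> openin U (W x) \<and> closedin U (D x) \<and> x \<in> W x \<and> W x \<subseteq> D x \<and> D x \<subseteq> V (i x)"
    by (elim exE)
  then have iWD: "openin U (W x)" "closedin U (D x)" "x \<in> W x" "W x \<subseteq> D x" "D x \<subseteq> V (i x)" if "x \<in> C" for x
    using that by simp_all
  have "compactin U C" using C compact by (simp add: closedin_compact_space)
  then have "\<exists>\<F>. finite \<F> \<and> \<F> \<subseteq> W ` C \<and> C \<subseteq> \<Union>\<F>"
    by (rule compactinD) (use iWD in auto)
  then obtain F where F: "finite F" "F \<subseteq> C" "C \<subseteq> (\<Union>x\<in>F. W x)"
    by (metis finite_subset_image)
  \<comment> \<open>Several points of \<open>F\<close> may have chosen the same index. Their closed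
    sets are merged, so that the sum below runs over distinct indices and is dominated by the
    series.\<close>
  define D' where "D' j = (\<Union>x\<in>{x\<in>F. i x = j}. D x)" for j
  have D': "closedin U (D' j)" "D' j \<subseteq> V j" for j
  proof -
    show "closedin U (D' j)"
      unfolding D'_def using F iWD(2) by (intro closedin_Union) auto
    show "D' j \<subseteq> V j"
      unfolding D'_def using F(2) iWD(5) by blast
  qed
  have "l C \<le> l (\<Union>j\<in>i ` F. D' j)"
  proof (rule charge_mono, rule subsetI)
    fix x assume "x \<in> C"
    then obtain y where "y \<in> F" "x \<in> W y" using F by blast
    then have "x \<in> D' (i y)" unfolding D'_def using F iWD(4)[of y] by blast
    then show "x \<in> (\<Union>j\<in>i ` F. D' j)" using \<open>y \<in> F\<close> by blast
  qed
  also have "\<dots> \<le> (\<Sum>j\<in>i ` F. l (D' j))" using F by (intro charge_UN_le) auto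
  also have "\<dots> \<le> (\<Sum>j\<in>i ` F. inner_charge U l (V j))"
    by (intro sum_mono inner_charge_upper D')
  also have "\<dots> \<le> (\<Sum>j. inner_charge U l (V j))"
    using F by (intro sum_le_suminf) auto
  finally show "l C \<le> (\<Sum>j. inner_charge U l (V j))" .
qed

lemma outer_charge_UN_le:
  fixes A :: "nat \<Rightarrow> 'a set"
  assumes A: "\<And>i. A i \<subseteq> topspace U"
  shows "outer_charge U l (\<Union>i. A i) \<le> (\<Sum>i. outer_charge U l (A i))"
proof (cases "(\<Sum>i. outer_charge U l (A i)) = \<top>")
  case False
  show ?thesis
  proof (rule ennreal_le_epsilon)
    fix e :: real assume e: "0 < e"
    have "\<exists>V. openin U V \<and> A i \<subseteq> V \<and> inner_charge U l V \<le> outer_charge U l (A i) + ennreal (e * (1/2) ^ Suc i)" for i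
    proof -
      \<comment> \<open>In \<open>ennreal\<close> adding a positive number increases only finite
        values; finiteness of the single term follows from that of the series.\<close>
      have "outer_charge U l (A i) \<noteq> \<top>"
        using False ennreal_suminf_lessD[of "\<lambda>i. outer_charge U l (A i)" \<top>] by (simp add: less_top)
      then obtain r where r: "0 \<le> r" "outer_charge U l (A i) = ennreal r"
        by (cases "outer_charge U l (A i)") auto
      define p where "p = e * (1/2) ^ Suc i"
      have "0 < p" using e by (simp add: p_def)
      then have "outer_charge U l (A i) < outer_charge U l (A i) + ennreal (e * (1/2) ^ Suc i)"
        unfolding r(2) p_def[symmetric] using r(1)
        by (simp add: ennreal_plus[symmetric] ennreal_less_iff del: ennreal_plus)
      then show ?thesis
        unfolding outer_charge_def INF_less_iff by (auto intro: less_imp_le)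
    qed
    then obtain V where V: "\<And>i. openin U (V i)" "\<And>i. A i \<subseteq> V i"
      "\<And>i. inner_charge U l (V i) \<le> outer_charge U l (A i) + ennreal (e * (1/2) ^ Suc i)"
      by metis
    have "outer_charge U l (\<Union>i. A i) \<le> inner_charge U l (\<Union>i. V i)"
      using V by (intro outer_charge_lower) auto
    also have "\<dots> \<le> (\<Sum>i. inner_charge U l (V i))" by (rule inner_charge_UN_le[OF V(1)])
    also have "\<dots> \<le> (\<Sum>i. outer_charge U l (A i) + ennreal (e * (1/2) ^ Suc i))"
      by (intro suminf_le V(3)) auto
    also have "\<dots> = (\<Sum>i. outer_charge U l (A i)) + (\<Sum>i. ennreal (e * (1/2) ^ Suc i))"
      by (rule suminf_add[symmetric]) auto
    also have "(\<Sum>i. ennreal (e * (1/2) ^ Suc i)) = ennreal (e * 1)"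
      using e by (intro suminf_ennreal_eq sums_mult power_half_series) auto
    finally show "outer_charge U l (\<Union>i. A i) \<le> (\<Sum>i. outer_charge U l (A i)) + ennreal e" by simp
  qed
qed simp

text \<open>Exhaust in two stages. For closed \<open>C\<close> inside \<open>W \<inter> V\<close>
  the set \<open>W - C\<close> is open and contains \<open>A - V\<close>; a closed \<open>D\<close>
  inside it is disjoint from \<open>C\<close>, and \<open>C \<union> D\<close> is a closed subset of
  \<open>W\<close>.\<close>

lemma outer_charge_split:
  assumes V: "openin U V"
  shows "outer_charge U l (A \<inter> V) + outer_charge U l (A - V) \<le> outer_charge U l A"
  unfolding outer_charge_def[of U l A]
proof (rule INF_greatest, clarify)
  fix W assume W: "openin U W" "A \<subseteq> W"
  have *: "l C + outer_charge U l (A - V) \<le> inner_charge U l W" if C: "closedin U C" "C \<subseteq> W \<inter> V" for C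
  proof -
    have "l C + outer_charge U l (A - V) \<le> l C + inner_charge U l (W - C)"
      using W C by (intro add_left_mono outer_charge_lower openin_diff) auto
    also have "\<dots> = (SUP D\<in>{D. closedin U D \<and> D \<subseteq> W - C}. l C + l D)"
      unfolding inner_charge_def by (subst ennreal_SUP_add_right) auto
    also have "\<dots> \<le> inner_charge U l W"
    proof (rule SUP_least, clarify)
      fix D assume D: "closedin U D" "D \<subseteq> W - C"
      then have "l C + l D = l (C \<union> D)" by (intro charge_Un[symmetric]) auto
      also have "\<dots> \<le> inner_charge U l W" using C D by (intro inner_charge_upper) auto
      finally show "l C + l D \<le> inner_charge U l W" .
    qed
    finally show ?thesis .
  qed
  have "outer_charge U l (A \<inter> V) + outer_charge U l (A - V)
      \<le> inner_charge U l (W \<inter> V) + outer_charge U l (A - V)"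
    using W V by (intro add_right_mono outer_charge_lower) auto
  also have "\<dots> = (SUP C\<in>{C. closedin U C \<and> C \<subseteq> W \<inter> V}. l C + outer_charge U l (A - V))"
    unfolding inner_charge_def by (subst ennreal_SUP_add_left) auto
  also have "\<dots> \<le> inner_charge U l W" by (rule SUP_least) (use * in auto)
  finally show "outer_charge U l (A \<inter> V) + outer_charge U l (A - V) \<le> inner_charge U l W" .
qed

text \<open>On open sets only an upper bound survives, which is the direction that Bowen balls
  require. No total mass is lost, because the whole space is closed as well as open.\<close>

lemma borel_measure_below_charge:
  obtains \<mu> where "space \<mu> = topspace U" "sets \<mu> = sigma_sets (topspace U) {S. openin U S}"
    "\<And>V. openin U V \<Longrightarrow> emeasure \<mu> V \<le> l V" "emeasure \<mu> (topspace U) = l (topspace U)"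
proof -
  let ?X = "topspace U" and ?g = "outer_charge U l"
  let ?B = "sigma_sets ?X {S. openin U S}"
  interpret P: sigma_algebra ?X "Pow ?X" by (rule sigma_algebra_Pow)
  have om: "outer_measure_space (Pow ?X) ?g"
    unfolding outer_measure_space_def positive_def increasing_def countably_subadditive_def
    by (auto simp: outer_charge_empty intro: outer_charge_mono intro!: outer_charge_UN_le)
  let ?L = "lambda_system ?X (Pow ?X) ?g"
  have ms: "measure_space ?X ?L ?g" by (rule P.caratheodory_lemma[OF om])
  have sub: "{S. openin U S} \<subseteq> ?L"
  proof clarify
    fix V assume V: "openin U V"
    have "?g (A \<inter> V) + ?g (A - V) = ?g A" if A: "A \<subseteq> ?X" for A
    proof (rule antisym)
      have "?g A \<le> ?g (\<Union>i. binaryset (A \<inter> V) (A - V) i)"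
        by (rule outer_charge_mono) (auto simp: UN_binaryset_eq)
      also have "\<dots> \<le> (\<Sum>i. ?g (binaryset (A \<inter> V) (A - V) i))"
        using A by (intro outer_charge_UN_le) (auto simp: binaryset_def)
      also have "\<dots> = ?g (A \<inter> V) + ?g (A - V)"
        by (rule suminf_binaryset_eq) (rule outer_charge_empty)
      finally show "?g A \<le> ?g (A \<inter> V) + ?g (A - V)" .
    qed (rule outer_charge_split[OF V])
    then show "V \<in> ?L" unfolding P.lambda_system_eq using openin_subset[OF V] by auto
  qed
  have opP: "{S. openin U S} \<subseteq> Pow ?X" using openin_subset by auto
  have BL: "?B \<subseteq> ?L"
    using ms sub by (intro sigma_algebra.sigma_sets_subset) (auto simp: measure_space_def)
  have "measure_space ?X ?B ?g"
    by (rule measure_down[OF ms sigma_algebra_sigma_sets[OF opP] BL])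
  then have em: "emeasure (measure_of ?X ?B ?g) S = ?g S" if "S \<in> ?B" for S
    using that by (intro emeasure_measure_of_sigma) (auto simp: measure_space_def)
  have sp: "space (measure_of ?X ?B ?g) = ?X" 
    by (rule space_measure_of) (use sigma_sets_into_sp[OF opP] in auto)
  have se: "sets (measure_of ?X ?B ?g) = ?B"
    by (rule sigma_algebra.sets_measure_of_eq[OF sigma_algebra_sigma_sets[OF opP]])
  show ?thesis
  proof (rule that[of "measure_of ?X ?B ?g"])
    show "emeasure (measure_of ?X ?B ?g) V \<le> l V" if "openin U V" for V
      using that em[of V] inner_charge_le[of V] by (simp add: outer_charge_openin sigma_sets.Basic)
    have "l ?X \<le> inner_charge U l ?X" by (intro inner_charge_upper) auto
    then show "emeasure (measure_of ?X ?B ?g) ?X = l ?X"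
      using em[of ?X] inner_charge_le[of ?X] by (simp add: outer_charge_openin sigma_sets_top)
  qed (rule sp se)+
qed

end

section \<open>Compactness, saturation and Vitali selection\<close>

text \<open>This is meant for functions on all subsets, whose product topology need not be first
  countable, so a convergent subsequence may be missing. A cluster point still inherits every closed
  condition that holds eventually.\<close>

lemma compact_sequence_cluster:
  fixes q :: "nat \<Rightarrow> 'b::topological_space"
  assumes "compact C" "\<And>M. q M \<in> C"
  obtains l where "l \<in> C" "\<And>S. closed S \<Longrightarrow> \<forall>\<^sub>F M in sequentially. q M \<in> S \<Longrightarrow> l \<in> S"
proof -
  have "filtermap q sequentially \<noteq> bot" by (simp add: filtermap_bot_iff)
  moreover have "\<forall>\<^sub>F x in filtermap q sequentially. x \<in> C"
    using assms(2) by (simp add: eventually_filtermap)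
  ultimately obtain l where l: "l \<in> C" "inf (nhds l) (filtermap q sequentially) \<noteq> bot"
    using assms(1) unfolding compact_filter by blast
  have "l \<in> S" if S: "closed S" "\<forall>\<^sub>F M in sequentially. q M \<in> S" for S
  proof (rule ccontr)
    assume "l \<notin> S"
    then have "\<forall>\<^sub>F x in nhds l. x \<in> - S"
      using S(1) by (intro eventually_nhds_in_open) auto
    moreover have "\<forall>\<^sub>F x in filtermap q sequentially. x \<in> S"
      using S(2) by (simp add: eventually_filtermap)
    ultimately have "\<forall>\<^sub>F x in inf (nhds l) (filtermap q sequentially). False"
      unfolding eventually_inf by (intro exI[of _ "\<lambda>x. x \<in> - S"] exI[of _ "\<lambda>x. x \<in> S"]) auto
    then show False using l(2) by (simp add: eventually_False)
  qed
  with l(1) that show thesis by blast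
qed

lemma compact_fun_unit_interval: "compact {f :: 'b \<Rightarrow> real. \<forall>x. f x \<in> {0..1}}"
proof -
  have "compactin (product_topology (\<lambda>i::'b. euclidean) UNIV) (PiE UNIV (\<lambda>_. {0..1::real}))"
    by (subst compactin_PiE) simp
  also have "PiE UNIV (\<lambda>_::'b. {0..1::real}) = {f. \<forall>x. f x \<in> {0..1}}"
    by (auto simp: PiE_def Pi_def extensional_def)
  finally show ?thesis by (simp add: euclidean_product_topology)
qed

text \<open>Greedy construction: the points of \<open>E\<close> are treated one by one, and the
  weight of each is raised by the least slack among the sets containing it. A set attaining this
  slack becomes saturated, and no bound is violated.\<close>

lemma saturated_weights:
  fixes S :: "'j \<Rightarrow> 'b set" and b :: "'j \<Rightarrow> real"
  assumes E: "finite E" and J: "finite J" and b: "\<And>j. j \<in> J \<Longrightarrow> 0 \<le> b j"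
    and cover: "E \<subseteq> (\<Union>j\<in>J. S j)"
  obtains w :: "'b \<Rightarrow> real" where "\<And>x. 0 \<le> w x" "\<And>j. j \<in> J \<Longrightarrow> sum w (E \<inter> S j) \<le> b j"
    "\<And>x. x \<in> E \<Longrightarrow> \<exists>j\<in>J. x \<in> S j \<and> sum w (E \<inter> S j) = b j"
proof -
  have "\<exists>w :: 'b \<Rightarrow> real. (\<forall>x. 0 \<le> w x) \<and> (\<forall>j\<in>J. sum w (E \<inter> S j) \<le> b j) \<and>
      (\<forall>x\<in>F. \<exists>j\<in>J. x \<in> S j \<and> sum w (E \<inter> S j) = b j)" if "F \<subseteq> E" for F
    using finite_subset[OF that E] that
  proof (induction F rule: finite_induct)
    case empty
    show ?case using b by (intro exI[of _ "\<lambda>_. 0"]) auto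
  next
    case (insert y F)
    then obtain w :: "'b \<Rightarrow> real" where w: "\<And>x. 0 \<le> w x" "\<And>j. j \<in> J \<Longrightarrow> sum w (E \<inter> S j) \<le> b j"
      "\<And>x. x \<in> F \<Longrightarrow> \<exists>j\<in>J. x \<in> S j \<and> sum w (E \<inter> S j) = b j"
      by (metis insert_subset)
    define Jy where "Jy = {j\<in>J. y \<in> S j}"
    have Jy: "finite Jy" "Jy \<noteq> {}" using J cover insert.prems by (auto simp: Jy_def)
    define t where "t = Min ((\<lambda>j. b j - sum w (E \<inter> S j)) ` Jy)"
    have t_le: "t \<le> b j - sum w (E \<inter> S j)" if "j \<in> Jy" for j
      unfolding t_def using Jy that by (intro Min_le) auto
    have "t \<in> (\<lambda>j. b j - sum w (E \<inter> S j)) ` Jy"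
      unfolding t_def using Jy by (intro Min_in) auto
    then obtain i where i: "i \<in> Jy" "t = b i - sum w (E \<inter> S i)" by blast
    have t0: "0 \<le> t" using i w(2)[of i] by (simp add: Jy_def)
    define v where "v = (\<lambda>x. w x + (if x = y then t else 0))"
    have v: "sum v (E \<inter> S j) = sum w (E \<inter> S j) + (if y \<in> S j then t else 0)" for j
      unfolding v_def using insert.prems E by (simp add: sum.distrib)
    have "\<exists>j\<in>J. x \<in> S j \<and> sum v (E \<inter> S j) = b j" if x: "x \<in> insert y F" for x
    proof (cases "x = y")
      case True
      then show ?thesis using i by (intro bexI[of _ i]) (auto simp: v Jy_def)
    next
      case False
      then obtain j where j: "j \<in> J" "x \<in> S j" "sum w (E \<inter> S j) = b j" using w(3)[of x] x by auto
      \<comment> \<open>A saturated set containing \<open>y\<close> has slack 0, which forces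
        \<open>t = 0\<close>; hence raising the weight of \<open>y\<close> never destroys earlier
        saturation.\<close>
      have "t = 0" if "y \<in> S j" using t_le[of j] t0 j that by (simp add: Jy_def)
      then show ?thesis using j by (intro bexI[of _ j]) (auto simp: v)
    qed
    moreover have "sum v (E \<inter> S j) \<le> b j" if "j \<in> J" for j
      using w(2)[OF that] t_le[of j] that by (auto simp: v Jy_def)
    moreover have "0 \<le> v x" for x using w(1)[of x] t0 by (simp add: v_def)
    ultimately show ?case by blast
  qed
  from this[OF order_refl] that show thesis by metis
qed

text \<open>Greedy selection: keep an index of least rank, discard all sets that meet its set, and
  recurse on the rest. Whatever is discarded has rank at least that of the index kept.\<close>

lemma disjoint_subselection:
  fixes S :: "'j \<Rightarrow> 'b set" and rank :: "'j \<Rightarrow> nat"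
  assumes "finite J" "\<And>j. j \<in> J \<Longrightarrow> S j \<noteq> {}"
  shows "\<exists>D\<subseteq>J. disjoint_family_on S D \<and> (\<forall>j\<in>J. \<exists>i\<in>D. rank i \<le> rank j \<and> S i \<inter> S j \<noteq> {})"
  using assms
proof (induction "card J" arbitrary: J rule: less_induct)
  case less
  show ?case
  proof (cases "J = {}")
    case True
    then show ?thesis by (simp add: disjoint_family_on_def)
  next
    case False
    then obtain i where i: "i \<in> J" "\<And>j. j \<in> J \<Longrightarrow> rank i \<le> rank j"
      using ex_has_least_nat[of "\<lambda>i. i \<in> J" _ rank] by blast
    define J' where "J' = {j\<in>J. S i \<inter> S j = {}}"
    \<comment> \<open>As \<open>S i\<close> is non-empty it meets itself, so \<open>i\<close> is
      removed too and the cardinality drops.\<close>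
    have "J' \<subset> J" using i less.prems(2)[of i] by (auto simp: J'_def)
    then have "card J' < card J" "finite J'" "\<And>j. j \<in> J' \<Longrightarrow> S j \<noteq> {}"
      using less.prems by (auto intro: psubset_card_mono finite_subset)
    then obtain D where D: "D \<subseteq> J'" "disjoint_family_on S D"
      "\<And>j. j \<in> J' \<Longrightarrow> \<exists>i\<in>D. rank i \<le> rank j \<and> S i \<inter> S j \<noteq> {}"
      using less.hyps[of J'] by blast
    have "\<exists>k\<in>insert i D. rank k \<le> rank j \<and> S k \<inter> S j \<noteq> {}" if "j \<in> J" for j
      using D(3)[of j] i(2)[OF that] that by (cases "j \<in> J'") (auto simp: J'_def)
    moreover have "disjoint_family_on S (insert i D)"
      using D(1,2) unfolding J'_def disjoint_family_on_def by fast
    moreover have "insert i D \<subseteq> J" using D(1) i(1) by (auto simp: J'_def)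
    ultimately show ?thesis by blast
  qed
qed

text \<open>The exceptional sets to which this is applied are not known to be measurable, so they
  are enclosed in measurable sets of measure at most \<open>1 / real (Suc j)\<close>, whose
  intersection is null.\<close>

lemma null_cover_of_small_covers:
  assumes "\<And>e::real. 0 < e \<Longrightarrow> \<exists>V\<in>sets \<mu>. E \<subseteq> V \<and> emeasure \<mu> V \<le> ennreal e"
  shows "\<exists>V\<in>null_sets \<mu>. E \<subseteq> V"
proof -
  have "\<exists>V\<in>sets \<mu>. E \<subseteq> V \<and> emeasure \<mu> V \<le> ennreal (1 / real (Suc j))" for j
    by (rule assms) simp
  then obtain V where V: "\<And>j. V j \<in> sets \<mu>" "\<And>j. E \<subseteq> V j"
    "\<And>j. emeasure \<mu> (V j) \<le> ennreal (1 / real (Suc j))" by metis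
  have "emeasure \<mu> (\<Inter>j. V j) = 0"
  proof -
    have "emeasure \<mu> (\<Inter>j. V j) \<le> ennreal (1 / real (Suc j))" for j
    proof -
      have "emeasure \<mu> (\<Inter>j. V j) \<le> emeasure \<mu> (V j)" 
        by (rule emeasure_mono[OF _ V(1)]) (rule INT_lower, simp)
      also note V(3)[of j]
      finally show ?thesis .
    qed
    moreover have "(\<lambda>j. ennreal (1 / real (Suc j))) \<longlonglongrightarrow> ennreal 0"
      by (intro tendsto_ennrealI) (rule LIMSEQ_inverse_real_of_nat[unfolded inverse_eq_divide])
    ultimately have "emeasure \<mu> (\<Inter>j. V j) \<le> ennreal 0"
      by (intro LIMSEQ_le_const) auto
    then show ?thesis by simp
  qed
  moreover have "(\<Inter>j. V j) \<in> sets \<mu>" using V(1) by (intro sets.countable_INT) auto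
  ultimately show ?thesis using V(2) by (intro bexI[of _ "\<Inter>j. V j"]) auto
qed

lemma sum_le_infsum_ennreal:
  fixes f :: "'b \<Rightarrow> ennreal"
  assumes "finite F" "F \<subseteq> I" shows "sum f F \<le> (\<Sum>\<^sub>\<infinity>i\<in>I. f i)"
  unfolding nonneg_infsum_complete[of I f, simplified] using assms by (intro SUP_upper) auto

section \<open>Frostman measures for Bowen balls\<close>

lemma bowen_outer_at_le_finite:
  assumes D: "finite D" "\<And>p. p \<in> D \<Longrightarrow> snd p \<in> X 0 \<and> N \<le> fst p"
    and cover: "K \<subseteq> (\<Union>p\<in>D. bowen_ball X d T (fst p) (snd p) \<epsilon>)"
  shows "bowen_outer_at X d T K s \<epsilon> N \<le> ennreal (\<Sum>p\<in>D. exp (- (real (fst p) * s)))"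
proof -
  obtain h where h: "bij_betw h {0..<card D} D" using ex_bij_betw_nat_finite[OF D(1)] by blast
  have hD: "h i \<in> D" if "i \<in> {0..<card D}" for i using bij_betwE[OF h] that by blast
  have "bowen_cover X d T N \<epsilon> K {0..<card D} (\<lambda>i. snd (h i)) (\<lambda>i. fst (h i))"
    unfolding bowen_cover_def
  proof (intro conjI ballI)
    have "(\<Union>p\<in>h ` {0..<card D}. bowen_ball X d T (fst p) (snd p) \<epsilon>)
        = (\<Union>i\<in>{0..<card D}. bowen_ball X d T (fst (h i)) (snd (h i)) \<epsilon>)"
      by (simp only: image_image)
    then show "K \<subseteq> (\<Union>i\<in>{0..<card D}. bowen_ball X d T (fst (h i)) (snd (h i)) \<epsilon>)"
      using cover by (simp only: bij_betw_imp_surj_on[OF h])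
  qed (use hD D(2) in auto)
  then have "bowen_outer_at X d T K s \<epsilon> N
      \<le> (\<Sum>\<^sub>\<infinity>i\<in>{0..<card D}. ennreal (exp (- (real (fst (h i)) * s))))"
    unfolding bowen_outer_at_def
    by (intro Inf_lower CollectI exI[of _ "{0..<card D}"] exI[of _ "\<lambda>i. snd (h i)"]
        exI[of _ "\<lambda>i. fst (h i)"] conjI refl)
  also have "\<dots> = ennreal (\<Sum>i\<in>{0..<card D}. exp (- (real (fst (h i)) * s)))"
    by (simp add: infsum_finite)
  also have "(\<Sum>i\<in>{0..<card D}. exp (- (real (fst (h i)) * s))) = (\<Sum>p\<in>D. exp (- (real (fst p) * s)))"
    by (rule sum.reindex_bij_betw[OF h])
  finally show ?thesis .
qed

context nds
begin

section \<open>Geometry of Bowen balls\<close>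

lemma iter_in: "x \<in> X 0 \<Longrightarrow> iter T j x \<in> X j"
  using continuous_map_image_subset_topspace[OF iter_continuous[of j]]
  unfolding Metric_space.topspace_mtopology[OF metric] by blast

lemma mem_bowen_ball:
  "0 < n \<Longrightarrow> y \<in> bowen_ball X d T n x \<epsilon> \<longleftrightarrow> y \<in> X 0 \<and> (\<forall>j<n. d j (iter T j x) (iter T j y) < \<epsilon>)"
  unfolding bowen_ball_def bowen_dist_def mem_Collect_eq by (subst Max_less_iff) auto

lemma bowen_ball_center: "0 < n \<Longrightarrow> 0 < \<epsilon> \<Longrightarrow> x \<in> X 0 \<Longrightarrow> x \<in> bowen_ball X d T n x \<epsilon>"
  using iter_in by (simp add: mem_bowen_ball Metric_space.mdist_zero[OF metric])

lemma bowen_ball_commute: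
  "0 < n \<Longrightarrow> x \<in> X 0 \<Longrightarrow> y \<in> bowen_ball X d T n x \<epsilon> \<Longrightarrow> x \<in> bowen_ball X d T n y \<epsilon>"
  by (simp add: mem_bowen_ball Metric_space.commute[OF metric])

lemma bowen_ball_triangle:
  assumes "0 < n" "x \<in> X 0" "y \<in> bowen_ball X d T n x a" "z \<in> bowen_ball X d T n y b"
  shows "z \<in> bowen_ball X d T n x (a + b)"
proof -
  have "d j (iter T j x) (iter T j z) < a + b" if "j < n" for j
  proof -
    have "d j (iter T j x) (iter T j z) \<le> d j (iter T j x) (iter T j y) + d j (iter T j y) (iter T j z)"
      using assms by (intro Metric_space.triangle[OF metric] iter_in) (auto simp: mem_bowen_ball)
    also have "\<dots> < a + b" using assms that by (intro add_strict_mono) (auto simp: mem_bowen_ball)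
    finally show ?thesis .
  qed
  then show ?thesis using assms by (simp add: mem_bowen_ball)
qed

lemma bowen_ball_antimono: "0 < n \<Longrightarrow> n \<le> m \<Longrightarrow> bowen_ball X d T m x \<epsilon> \<subseteq> bowen_ball X d T n x \<epsilon>"
  by (auto simp: mem_bowen_ball)

lemma finite_bowen_net:
  assumes K: "compactin (Metric_space.mtopology (X 0) (d 0)) K" and "0 < n" "0 < \<epsilon>"
  obtains E where "finite E" "E \<subseteq> K" "K \<subseteq> (\<Union>x\<in>E. bowen_ball X d T n x \<epsilon>)"
proof -
  have KX: "K \<subseteq> X 0"
    using compactin_subset_topspace[OF K] by (simp add: Metric_space.topspace_mtopology[OF metric])
  have "\<exists>\<F>. finite \<F> \<and> \<F> \<subseteq> (\<lambda>x. bowen_ball X d T n x \<epsilon>) ` K \<and> K \<subseteq> \<Union>\<F>"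
    using assms(2,3) KX by (intro compactinD[OF K]) (auto intro!: bowen_ball_openin bowen_ball_center)
  then show thesis using that by (metis finite_subset_image)
qed

section \<open>Frostman charges for finitely many orders, and their limit\<close>

lemma finite_frostman:
  assumes K: "compactin (Metric_space.mtopology (X 0) (d 0)) K"
    and NM: "0 < N" "N \<le> M" and eps: "0 < \<epsilon>"
    and c: "0 < c" "ennreal c \<le> bowen_outer_at X d T K s (4 * \<epsilon>) N"
  obtains q :: "'a set \<Rightarrow> real" where "\<And>A. q A \<in> {0..1}" "\<And>A B. A \<inter> B = {} \<Longrightarrow> q (A \<union> B) = q A + q B"
    "q (X 0) = 1" "q (X 0 - K) = 0"
    "\<And>n x. x \<in> X 0 \<Longrightarrow> N \<le> n \<Longrightarrow> n \<le> M \<Longrightarrow> q (bowen_ball X d T n x (\<epsilon> / 2)) \<le> exp (- (real n * s)) / c"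
proof -
  have KX: "K \<subseteq> X 0"
    using compactin_subset_topspace[OF K] by (simp add: Metric_space.topspace_mtopology[OF metric])
  have "0 < M" using NM by simp
  \<comment> \<open>The net is taken in the finest metric, that of order \<open>M\<close>; it is
    then a net for every order between \<open>N\<close> and \<open>M\<close> too.\<close>
  then obtain E where E: "finite E" "E \<subseteq> K" "K \<subseteq> (\<Union>x\<in>E. bowen_ball X d T M x \<epsilon>)"
    using finite_bowen_net[OF K _ eps] by blast
  define J where "J = {N..M} \<times> E"
  define S where "S = (\<lambda>p. bowen_ball X d T (fst p) (snd p) \<epsilon>)"
  have J: "finite J" using E by (simp add: J_def)
  have Jp: "0 < fst p" "N \<le> fst p" "fst p \<le> M" "snd p \<in> E" "snd p \<in> X 0" if "p \<in> J" for p
    using that NM E KX by (auto simp: J_def)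
  have "E \<subseteq> (\<Union>p\<in>J. S p)"
  proof
    fix x assume "x \<in> E"
    then have "x \<in> S (N, x)" "(N, x) \<in> J"
      using NM E KX eps by (auto simp: S_def J_def intro!: bowen_ball_center)
    then show "x \<in> (\<Union>p\<in>J. S p)" by blast
  qed
  then obtain w :: "'a \<Rightarrow> real" where w: "\<And>x. 0 \<le> w x"
    "\<And>p. p \<in> J \<Longrightarrow> sum w (E \<inter> S p) \<le> exp (- (real (fst p) * s))"
    "\<And>x. x \<in> E \<Longrightarrow> \<exists>p\<in>J. x \<in> S p \<and> sum w (E \<inter> S p) = exp (- (real (fst p) * s))"
    using saturated_weights[OF E(1) J, of "\<lambda>p. exp (- (real (fst p) * s))" S] by (metis exp_ge_zero)
  define W where "W = sum w E"
  define J' where "J' = {p\<in>J. sum w (E \<inter> S p) = exp (- (real (fst p) * s))}"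
  have "\<exists>D\<subseteq>J'. disjoint_family_on S D \<and> (\<forall>j\<in>J'. \<exists>i\<in>D. fst i \<le> fst j \<and> S i \<inter> S j \<noteq> {})"
  proof (rule disjoint_subselection)
    show "finite J'" using J by (simp add: J'_def)
    fix p assume "p \<in> J'"
    then have "snd p \<in> S p" unfolding S_def
      using Jp[of p] eps by (intro bowen_ball_center) (auto simp: J'_def)
    then show "S p \<noteq> {}" by blast
  qed
  then obtain D where D: "D \<subseteq> J'" "disjoint_family_on S D"
    "\<And>j. j \<in> J' \<Longrightarrow> \<exists>i\<in>D. fst i \<le> fst j \<and> S i \<inter> S j \<noteq> {}"
    by blast
  have DJ: "D \<subseteq> J" using D(1) by (auto simp: J'_def)
  have finD: "finite D" using finite_subset[OF DJ J] .
  \<comment> \<open>Saturation turns the cover weights of \<open>D\<close> into weights of disjoint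
    parts of \<open>E\<close>, so their sum is at most the total weight.\<close>
  have "(\<Sum>p\<in>D. exp (- (real (fst p) * s))) = (\<Sum>p\<in>D. sum w (E \<inter> S p))"
    using D(1) by (intro sum.cong) (auto simp: J'_def)
  also have "\<dots> = sum w (\<Union>p\<in>D. E \<inter> S p)"
    using finD E(1) D(2) unfolding disjoint_family_on_def
    by (intro sum.UNION_disjoint[symmetric]) blast+
  also have "\<dots> \<le> W"
    unfolding W_def using E(1) w(1) by (intro sum_mono2) auto
  finally have "(\<Sum>p\<in>D. exp (- (real (fst p) * s))) \<le> W" .
  moreover have "bowen_outer_at X d T K s (4 * \<epsilon>) N \<le> ennreal (\<Sum>p\<in>D. exp (- (real (fst p) * s)))"
  proof (rule bowen_outer_at_le_finite[OF finD])
    show "snd p \<in> X 0 \<and> N \<le> fst p" if "p \<in> D" for p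
      using Jp[of p] that DJ by auto
    \<comment> \<open>From the centre of \<open>i\<close> a chain leads through \<open>z\<close>,
      the centre of \<open>j\<close> and the net point \<open>x\<close> to \<open>y\<close>. Each of
      the four links is shorter than \<epsilon> in the metric of order \<open>fst i\<close>, the
      smallest order involved; this gives the factor 4.\<close>
    show "K \<subseteq> (\<Union>p\<in>D. bowen_ball X d T (fst p) (snd p) (4 * \<epsilon>))"
    proof
      fix y assume "y \<in> K"
      then obtain x where x: "x \<in> E" "y \<in> bowen_ball X d T M x \<epsilon>" using E(3) by blast
      obtain j where j: "j \<in> J'" "x \<in> S j" using w(3)[OF x(1)] by (auto simp: J'_def)
      obtain i z where i: "i \<in> D" "fst i \<le> fst j" "z \<in> S i" "z \<in> S j" using D(3)[OF j(1)] by blast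
      have jJ: "j \<in> J" and iJ: "i \<in> J" using j(1) i(1) DJ by (auto simp: J'_def)
      let ?n = "fst i"
      have n: "0 < ?n" using Jp(1)[OF iJ] .
      have 1: "z \<in> bowen_ball X d T ?n (snd i) \<epsilon>" using i(3) by (simp add: S_def)
      have "snd j \<in> bowen_ball X d T (fst j) z \<epsilon>"
        using bowen_ball_commute[OF Jp(1)[OF jJ] Jp(5)[OF jJ]] i(4) unfolding S_def by blast
      then have 2: "snd j \<in> bowen_ball X d T ?n z \<epsilon>" using bowen_ball_antimono[OF n i(2)] by blast
      have 3: "x \<in> bowen_ball X d T ?n (snd j) \<epsilon>"
        using bowen_ball_antimono[OF n i(2)] j(2) unfolding S_def by blast
      have 4: "y \<in> bowen_ball X d T ?n x \<epsilon>" using bowen_ball_antimono[OF n Jp(3)[OF iJ]] x(2) by blast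
      note bowen_ball_triangle[OF n Jp(5)[OF iJ] bowen_ball_triangle[OF n Jp(5)[OF iJ]
            bowen_ball_triangle[OF n Jp(5)[OF iJ] 1 2] 3] 4]
      then show "y \<in> (\<Union>p\<in>D. bowen_ball X d T (fst p) (snd p) (4 * \<epsilon>))"
        using i(1) by (auto simp: algebra_simps)
    qed
  qed
  ultimately have "ennreal c \<le> ennreal W"
    using c(2) by (meson ennreal_leI order_trans)
  then have cW: "c \<le> W" "0 < W"
    using c(1) by (auto simp: ennreal_le_iff2)
  define q where "q A = sum w (E \<inter> A) / W" for A
  show thesis
  proof (rule that[of q])
    fix A
    have "0 \<le> sum w (E \<inter> A)" using w(1) by (intro sum_nonneg) auto
    moreover have "sum w (E \<inter> A) \<le> W" unfolding W_def using w(1) E(1) by (intro sum_mono2) auto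
    ultimately show "q A \<in> {0..1}" using cW by (simp add: q_def)
  next
    fix A B :: "'a set" assume "A \<inter> B = {}"
    then have "(E \<inter> A) \<inter> (E \<inter> B) = {}" by blast
    then have "sum w (E \<inter> (A \<union> B)) = sum w (E \<inter> A) + sum w (E \<inter> B)"
      using sum.union_disjoint[of "E \<inter> A" "E \<inter> B" w] E(1) by (simp add: Int_Un_distrib)
    then show "q (A \<union> B) = q A + q B" by (simp add: q_def add_divide_distrib)
  next
    have "E \<inter> X 0 = E" "E \<inter> (X 0 - K) = {}" using E(2) KX by auto
    then show "q (X 0) = 1" "q (X 0 - K) = 0" using cW by (auto simp: q_def W_def)
  next
    fix n x assume x: "x \<in> X 0" and n: "N \<le> n" "n \<le> M"
    have n0: "0 < n" using n NM by simp
    show "q (bowen_ball X d T n x (\<epsilon> / 2)) \<le> exp (- (real n * s)) / c"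
    \<comment> \<open>Constraints exist only for centres in \<open>E\<close>. A ball that meets
      \<open>E\<close> is recentred at a common point \<open>e\<close>, which doubles its radius;
      hence \<epsilon> / 2 in the bound. A ball that misses \<open>E\<close> has charge 0.\<close>
    proof (cases "E \<inter> bowen_ball X d T n x (\<epsilon> / 2) = {}")
      case True
      then show ?thesis using c(1) by (simp add: q_def)
    next
      case False
      then obtain e where e: "e \<in> E" "e \<in> bowen_ball X d T n x (\<epsilon> / 2)" by blast
      have eX: "e \<in> X 0" using e(1) E(2) KX by blast
      have "bowen_ball X d T n x (\<epsilon> / 2) \<subseteq> S (n, e)"
        using bowen_ball_triangle[OF n0 eX bowen_ball_commute[OF n0 x e(2)], of _ "\<epsilon> / 2"] by (auto simp: S_def)
      then have "E \<inter> bowen_ball X d T n x (\<epsilon> / 2) \<subseteq> E \<inter> S (n, e)" by (rule Int_mono[OF order_refl])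
      then have "sum w (E \<inter> bowen_ball X d T n x (\<epsilon> / 2)) \<le> sum w (E \<inter> S (n, e))"
        by (rule sum_mono2[rotated]) (simp_all add: E(1) w(1))
      also have "\<dots> \<le> exp (- (real n * s))"
        using w(2)[of "(n, e)"] n e(1) unfolding J_def by simp
      finally show ?thesis
        unfolding q_def using cW c(1) by (intro frac_le) auto
    qed
  qed
qed

text \<open>Each instance of the requirements in \<open>good\<close> is a closed condition on
  finitely many values of \<open>q\<close>, so it passes to a cluster point. The upper limit on the
  orders disappears, because a given \<open>n\<close> is eventually at most
  \<open>N + M\<close>.\<close>

lemma frostman_measure:
  assumes K: "compactin (Metric_space.mtopology (X 0) (d 0)) K"
    and N: "0 < N" and eps: "0 < \<epsilon>"
    and c: "0 < c" "ennreal c \<le> bowen_outer_at X d T K s (4 * \<epsilon>) N"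
  obtains \<mu> where "\<mu> \<in> borel_prob_measures (Metric_space.mtopology (X 0) (d 0))" "measure \<mu> K = 1"
    "\<And>n x. x \<in> X 0 \<Longrightarrow> N \<le> n \<Longrightarrow> measure \<mu> (bowen_ball X d T n x (\<epsilon> / 2)) \<le> exp (- (real n * s)) / c"
proof -
  let ?U = "Metric_space.mtopology (X 0) (d 0)"
  have top: "topspace ?U = X 0" by (rule Metric_space.topspace_mtopology[OF metric])
  have KX: "K \<subseteq> X 0" using compactin_subset_topspace[OF K] by (simp add: top)
  define good where "good M q \<longleftrightarrow> (\<forall>A. q A \<in> {0..1}) \<and> (\<forall>A B. A \<inter> B = {} \<longrightarrow> q (A \<union> B) = q A + q B) \<and>
      q (X 0) = 1 \<and> q (X 0 - K) = 0 \<and>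
      (\<forall>n x. x \<in> X 0 \<longrightarrow> N \<le> n \<longrightarrow> n \<le> M \<longrightarrow> q (bowen_ball X d T n x (\<epsilon> / 2)) \<le> exp (- (real n * s)) / c)"
    for M and q :: "'a set \<Rightarrow> real"
  have "\<exists>q. good (N + M) q" for M
  proof -
    have "N \<le> N + M" by simp
    then show ?thesis
      by (rule finite_frostman[OF K N _ eps c]) (unfold good_def, rule exI, intro conjI allI impI)
  qed
  then obtain q where "\<And>M. good (N + M) (q M)" by metis
  then have q: "\<And>M A. q M A \<in> {0..1}"
    "\<And>M A B. A \<inter> B = {} \<Longrightarrow> q M (A \<union> B) = q M A + q M B"
    "\<And>M. q M (X 0) = 1" "\<And>M. q M (X 0 - K) = 0"
    "\<And>M n x. x \<in> X 0 \<Longrightarrow> N \<le> n \<Longrightarrow> n \<le> N + M \<Longrightarrow> q M (bowen_ball X d T n x (\<epsilon> / 2)) \<le> exp (- (real n * s)) / c"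
    unfolding good_def by blast+
  obtain l where l: "\<forall>A. l A \<in> {0..1}"
    and cl: "\<And>S. closed S \<Longrightarrow> \<forall>\<^sub>F M in sequentially. q M \<in> S \<Longrightarrow> l \<in> S"
  proof (rule compact_sequence_cluster[OF compact_fun_unit_interval, of q])
    show "q M \<in> {f. \<forall>x. f x \<in> {0..1}}" for M using q(1) by simp
  qed simp
  have coord: "continuous_on UNIV (\<lambda>f :: 'a set \<Rightarrow> real. f A)" for A
    by (rule continuous_on_product_coordinates)
  have lUn: "l (A \<union> B) = l A + l B" if "A \<inter> B = {}" for A B
    using cl[of "{f. f (A \<union> B) = f A + f B}"] q(2)[OF that]
    by (simp add: closed_Collect_eq coord continuous_on_add)
  have l1: "l (X 0) = 1"
    using cl[of "{f. f (X 0) = 1}"] q(3) by (simp add: closed_Collect_eq coord)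
  have l0: "l (X 0 - K) = 0"
    using cl[of "{f. f (X 0 - K) = 0}"] q(4) by (simp add: closed_Collect_eq coord)
  have lB: "l (bowen_ball X d T n x (\<epsilon> / 2)) \<le> exp (- (real n * s)) / c" if "x \<in> X 0" "N \<le> n" for n x
  proof -
    have "\<forall>\<^sub>F M in sequentially. q M \<in> {f. f (bowen_ball X d T n x (\<epsilon> / 2)) \<le> exp (- (real n * s)) / c}"
      using eventually_ge_at_top[of n] by eventually_elim (use q(5)[OF that] in auto)
    then show ?thesis
      using cl[of "{f. f (bowen_ball X d T n x (\<epsilon> / 2)) \<le> exp (- (real n * s)) / c}"]
      by (simp add: closed_Collect_le coord)
  qed
  interpret compact_charge ?U "\<lambda>A. ennreal (l A)"
  proof
    show "compact_space ?U" by (rule compact)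
    show "Hausdorff_space ?U" by (rule Metric_space.Hausdorff_space_mtopology[OF metric])
    show "ennreal (l {}) = 0" using lUn[of "{}" "{}"] by simp
    show "ennreal (l (A \<union> B)) = ennreal (l A) + ennreal (l B)" if "A \<inter> B = {}" for A B
      using l lUn[OF that] by (simp add: ennreal_plus)
  qed
  obtain \<mu> where \<mu>: "space \<mu> = X 0" "sets \<mu> = sigma_sets (X 0) {S. openin ?U S}"
    "\<And>V. openin ?U V \<Longrightarrow> emeasure \<mu> V \<le> ennreal (l V)" "emeasure \<mu> (X 0) = ennreal (l (X 0))"
    using borel_measure_below_charge unfolding top by blast
  have prob: "prob_space \<mu>" by (rule prob_spaceI) (simp add: \<mu> l1)
  interpret prob_space \<mu> by (rule prob)
  have meas: "measure \<mu> V \<le> l V" if "openin ?U V" for V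
    using \<mu>(3)[OF that] l by (simp add: emeasure_eq_measure)
  show thesis
  proof (rule that[of \<mu>])
    show "\<mu> \<in> borel_prob_measures ?U" using prob \<mu> by (simp add: borel_prob_measures_def top)
    \<comment> \<open>The measure is compared with the charge on open sets, so the mass of
      \<open>K\<close> is read off from its complement, which is open and has charge 0.\<close>
    have "closedin ?U K"
      by (rule compactin_imp_closedin[OF Metric_space.Hausdorff_space_mtopology[OF metric] K])
    then have op: "openin ?U (X 0 - K)" by (auto simp: closedin_def top)
    then have "X 0 - K \<in> sets \<mu>" by (simp add: \<mu> sigma_sets.Basic)
    moreover have "measure \<mu> (X 0 - K) = 0" using meas[OF op] l0 by (simp add: measure_le_0_iff)
    ultimately have "measure \<mu> (space \<mu> - (X 0 - K)) = 1" by (simp add: prob_compl)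
    then show "measure \<mu> K = 1" using KX by (simp add: \<mu> double_diff)
    show "measure \<mu> (bowen_ball X d T n x (\<epsilon> / 2)) \<le> exp (- (real n * s)) / c" if "x \<in> X 0" "N \<le> n" for n x
      using meas[of "bowen_ball X d T n x (\<epsilon> / 2)"] lB[OF that] bowen_ball_openin[OF that(1), of n "\<epsilon> / 2"] that N by simp
  qed
qed

section \<open>Entropies\<close>

lemma local_lower_entropy_ge:
  assumes \<mu>: "\<mu> \<in> borel_prob_measures (Metric_space.mtopology (X 0) (d 0))" and x: "x \<in> X 0"
    and N: "0 < N" and eps: "0 < \<epsilon>" and c: "0 < c"
    and bound: "\<And>n. N \<le> n \<Longrightarrow> measure \<mu> (bowen_ball X d T n x \<epsilon>) \<le> exp (- (real n * s)) / c"
  shows "ereal s \<le> local_lower_entropy X d T \<mu> x"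
proof -
  interpret prob_space \<mu> using \<mu> by (simp add: borel_prob_measures_def)
  \<comment> \<open>By monotonicity in the radius the bound at \<epsilon> serves every smaller
    radius, which is all that the limit at 0 sees.\<close>
  have at: "ereal s \<le> local_lower_entropy_at X d T \<mu> x e" if e: "e \<le> \<epsilon>" for e
  proof -
    have quotient_ge: "ereal (s + ln c / real n)
        \<le> (- ereal_log (measure \<mu> (bowen_ball X d T n x e))) / ereal (real n)" if n: "N \<le> n" for n
    proof -
      define p where "p = measure \<mu> (bowen_ball X d T n x e)"
      have n0: "0 < n" using n N by simp
      have "bowen_ball X d T n x \<epsilon> \<in> sets \<mu>"
        using \<mu> bowen_ball_openin[OF x n0] by (auto simp: borel_prob_measures_def)
      then have "p \<le> measure \<mu> (bowen_ball X d T n x \<epsilon>)"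
        unfolding p_def by (intro finite_measure_mono bowen_ball_mono e)
      then have p_le: "p \<le> exp (- (real n * s)) / c" using bound[OF n] by (rule order_trans)
      show ?thesis
      proof (cases "p = 0")
        \<comment> \<open>Here \<open>ereal_log\<close> is -\<infinity>, so the quotient is
          \<infinity> as the order is positive.\<close>
        case True
        then show ?thesis using n0 by (simp add: p_def[symmetric] ereal_log_def)
      next
        case False
        then have "0 < p" by (simp add: p_def zero_less_measure_iff)
        then have "ln p \<le> ln (exp (- (real n * s)) / c)" using p_le by simp
        then have "ln p \<le> - (real n * s) - ln c" using c by (simp add: ln_div)
        then have "(real n * s + ln c) / real n \<le> - ln p / real n"
          by (intro divide_right_mono) auto
        then have "s + ln c / real n \<le> - ln p / real n"
          using n0 by (simp add: add_divide_distrib)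
        then show ?thesis using False n0 by (simp add: p_def[symmetric] ereal_log_def)
      qed
    qed
    \<comment> \<open>The constant \<open>c\<close> enters only through
      \<open>ln c / real n\<close>, which vanishes in the limit.\<close>
    have "(\<lambda>n. ereal (s + ln c / real n)) \<longlonglongrightarrow> ereal (s + 0)"
      by (intro tendsto_ereal tendsto_add tendsto_const lim_const_over_n)
    from lim_imp_Liminf[OF sequentially_bot this]
    have "ereal s = liminf (\<lambda>n. ereal (s + ln c / real n))" by simp
    also have "\<dots> \<le> local_lower_entropy_at X d T \<mu> x e"
      unfolding local_lower_entropy_at_def
      by (intro Liminf_mono eventually_mono[OF eventually_ge_at_top[of N]] quotient_ge)
    finally show ?thesis .
  qed
  have "\<forall>\<^sub>F e in at_right 0. e \<in> {0<..<\<epsilon>}" by (rule eventually_at_right_real[OF eps])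
  then have "\<forall>\<^sub>F e in at_right 0. ereal s \<le> local_lower_entropy_at X d T \<mu> x e"
    by (rule eventually_mono) (auto intro: at)
  then show ?thesis
    by (rule tendsto_lowerbound[OF local_lower_entropy_tendsto[OF \<mu> x]]) simp
qed

lemma exists_measure_lower_entropy_ge:
  assumes K: "compactin (Metric_space.mtopology (X 0) (d 0)) K"
    and eps: "0 < \<epsilon>" and pos: "bowen_outer X d T K s \<epsilon> \<noteq> 0"
  shows "\<exists>\<mu>. \<mu> \<in> borel_prob_measures (Metric_space.mtopology (X 0) (d 0)) \<and> measure \<mu> K = 1 \<and>
    ereal s \<le> lower_entropy X d T \<mu>"
proof -
  have "0 < (SUP N. bowen_outer_at X d T K s \<epsilon> N)"
    using pos by (simp add: bowen_outer_eq_SUP zero_less_iff_neq_zero)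
  then obtain N where "0 < bowen_outer_at X d T K s \<epsilon> N" by (auto simp: less_SUP_iff)
  \<comment> \<open>Passing to \<open>Suc N\<close> keeps the value positive and makes all orders
    positive, as the Frostman construction demands.\<close>
  also have "bowen_outer_at X d T K s \<epsilon> N \<le> bowen_outer_at X d T K s \<epsilon> (Suc N)"
    by (rule monoD[OF bowen_outer_at_incseq]) simp
  finally obtain z where z: "0 < z" "z < bowen_outer_at X d T K s \<epsilon> (Suc N)"
    using dense by blast
  \<comment> \<open>Lying strictly below another value, \<open>z\<close> is finite and so a real
    constant. The scale \<epsilon> is written as four times the Frostman radius, so that balls of
    radius \<epsilon> / 8 are controlled.\<close>
  then obtain c where c: "0 < ennreal c" "ennreal c < bowen_outer_at X d T K s (4 * (\<epsilon> / 4)) (Suc N)"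
    by (cases z) auto
  have c0: "0 < c" using c(1) by simp
  obtain \<mu> where \<mu>: "\<mu> \<in> borel_prob_measures (Metric_space.mtopology (X 0) (d 0))" "measure \<mu> K = 1"
    "\<And>n x. x \<in> X 0 \<Longrightarrow> Suc N \<le> n \<Longrightarrow> measure \<mu> (bowen_ball X d T n x (\<epsilon> / 4 / 2)) \<le> exp (- (real n * s)) / c"
    using frostman_measure[OF K zero_less_Suc _ c0 less_imp_le[OF c(2)]] eps by auto
  interpret prob_space \<mu> using \<mu> by (simp add: borel_prob_measures_def)
  have sp: "space \<mu> = X 0"
    using \<mu>(1) by (simp add: borel_prob_measures_def Metric_space.topspace_mtopology[OF metric])
  have "e2ennreal (ereal s) = (\<integral>\<^sup>+ x. e2ennreal (ereal s) \<partial>\<mu>)" by (simp add: emeasure_space_1)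
  also have "\<dots> \<le> (\<integral>\<^sup>+ x. e2ennreal (local_lower_entropy X d T \<mu> x) \<partial>\<mu>)"
    using local_lower_entropy_ge[OF \<mu>(1) _ zero_less_Suc _ c0 \<mu>(3)] eps sp
    by (intro nn_integral_mono e2ennreal_mono) auto
  finally have "enn2ereal (e2ennreal (ereal s)) \<le> lower_entropy X d T \<mu>"
    unfolding lower_entropy_def by (simp add: less_eq_ennreal.rep_eq)
  \<comment> \<open>A negative \<open>s\<close> is sent to 0 by the coercion to
    \<open>ennreal\<close>, which only enlarges it.\<close>
  moreover have "ereal s \<le> enn2ereal (e2ennreal (ereal s))"
    by (cases "0 \<le> s") (auto simp: ennreal_neg zero_ennreal.rep_eq)
  ultimately show ?thesis using \<mu>(1,2) order_trans by blast
qed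

section \<open>Upper bound: local entropies almost everywhere\<close>

lemma null_cover_of_large_entropy:
  assumes \<mu>: "\<mu> \<in> borel_prob_measures (Metric_space.mtopology (X 0) (d 0))"
    and KX: "K \<subseteq> X 0" and zero: "bowen_outer X d T K s \<epsilon> = 0" and k: "0 < k"
  shows "\<exists>V\<in>null_sets \<mu>.
    {x\<in>K. \<forall>n\<ge>k. measure \<mu> (bowen_ball X d T n x (2 * \<epsilon>)) < exp (- (real n * s))} \<subseteq> V"
    (is "\<exists>V\<in>_. ?E \<subseteq> V")
proof (rule null_cover_of_small_covers)
  fix e :: real assume e: "0 < e"
  interpret prob_space \<mu> using \<mu> by (simp add: borel_prob_measures_def)
  have ball_sets: "bowen_ball X d T n x a \<in> sets \<mu>" if "x \<in> X 0" "0 < n" for n x a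
    using \<mu> bowen_ball_openin[OF that] by (auto simp: borel_prob_measures_def)
  \<comment> \<open>The limit in the order is increasing, so a zero limit makes every term zero;
    this yields covers by balls of order at least \<open>k\<close> with total weight below
    \<open>e\<close>.\<close>
  have "bowen_outer_at X d T K s \<epsilon> k \<le> bowen_outer X d T K s \<epsilon>"
    unfolding bowen_outer_eq_SUP by (rule SUP_upper) simp
  then have "bowen_outer_at X d T K s \<epsilon> k < ennreal e" using zero e by simp
  then obtain I c m where cov: "bowen_cover X d T k \<epsilon> K I c m"
    and small: "(\<Sum>\<^sub>\<infinity>i\<in>I. ennreal (exp (- (real (m i) * s)))) < ennreal e"
    unfolding bowen_outer_at_def Inf_less_iff by blast
  have cm: "c i \<in> X 0" "0 < m i" "k \<le> m i" if "i \<in> I" for i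
    using cov k that unfolding bowen_cover_def by auto
  define B where "B i = bowen_ball X d T (m i) (c i) \<epsilon>" for i
  define I' where "I' = {i\<in>I. B i \<inter> ?E \<noteq> {}}"
  \<comment> \<open>Only balls meeting the exceptional set are kept; the others become empty, so
    that the family is indexed by all naturals.\<close>
  define A where "A i = (if i \<in> I' then B i else {})" for i
  have A_sets: "A i \<in> sets \<mu>" for i
    using ball_sets cm by (auto simp: A_def I'_def B_def)
  have A_le: "emeasure \<mu> (A i) \<le> (if i \<in> I' then ennreal (exp (- (real (m i) * s))) else 0)" for i
  proof (cases "i \<in> I'")
    case True
    then obtain y where y: "i \<in> I" "y \<in> B i" "y \<in> ?E" by (auto simp: I'_def)
    have yX: "y \<in> X 0" using y(3) KX by auto
    \<comment> \<open>Recentring the ball at \<open>y\<close> doubles the radius, hence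
      \<open>2 * \<epsilon>\<close> in the exceptional set; membership of \<open>y\<close> then
      bounds the measure by the weight of the ball.\<close>
    have "B i \<subseteq> bowen_ball X d T (m i) y (2 * \<epsilon>)"
      using bowen_ball_triangle[OF cm(2)[OF y(1)] yX
          bowen_ball_commute[OF cm(2)[OF y(1)] cm(1)[OF y(1)] y(2)[unfolded B_def]], of _ \<epsilon>]
      by (auto simp: B_def)
    then have "measure \<mu> (B i) \<le> measure \<mu> (bowen_ball X d T (m i) y (2 * \<epsilon>))"
      by (intro finite_measure_mono ball_sets yX cm(2)[OF y(1)])
    also have "\<dots> \<le> exp (- (real (m i) * s))" using y(3) cm(3)[OF y(1)] by auto
    finally show ?thesis using True by (simp add: A_def emeasure_eq_measure)
  qed (simp add: A_def)
  have "emeasure \<mu> (\<Union>i. A i) \<le> (\<Sum>i. emeasure \<mu> (A i))"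
    using A_sets by (intro emeasure_subadditive_countably) auto
  also have "\<dots> \<le> (\<Sum>i. if i \<in> I' then ennreal (exp (- (real (m i) * s))) else 0)"
    by (intro suminf_le A_le) auto
  also have "\<dots> \<le> (\<Sum>\<^sub>\<infinity>i\<in>I. ennreal (exp (- (real (m i) * s))))"
    unfolding suminf_eq_SUP
  proof (rule SUP_least)
    fix n :: nat
    have "(\<Sum>i<n. if i \<in> I' then ennreal (exp (- (real (m i) * s))) else 0)
        = (\<Sum>i\<in>{..<n} \<inter> I'. ennreal (exp (- (real (m i) * s))))"
      by (rule sum.inter_restrict[symmetric]) simp
    also have "\<dots> \<le> (\<Sum>\<^sub>\<infinity>i\<in>I. ennreal (exp (- (real (m i) * s))))"
      by (rule sum_le_infsum_ennreal) (auto simp: I'_def)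
    finally show "(\<Sum>i<n. if i \<in> I' then ennreal (exp (- (real (m i) * s))) else 0)
        \<le> (\<Sum>\<^sub>\<infinity>i\<in>I. ennreal (exp (- (real (m i) * s))))" .
  qed
  finally have "emeasure \<mu> (\<Union>i. A i) \<le> ennreal e" using small by simp
  moreover have "?E \<subseteq> (\<Union>i. A i)"
  proof
    fix x assume x: "x \<in> ?E"
    then obtain i where "i \<in> I" "x \<in> B i" using cov by (auto simp: bowen_cover_def B_def)
    then have "x \<in> A i" using x by (auto simp: A_def I'_def)
    then show "x \<in> (\<Union>i. A i)" by blast
  qed
  moreover have "(\<Union>i. A i) \<in> sets \<mu>" using A_sets by blast
  ultimately show "\<exists>V\<in>sets \<mu>. ?E \<subseteq> V \<and> emeasure \<mu> V \<le> ennreal e" by blast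
qed

text \<open>Off a countable union of null sets the ball measure is at least
  \<open>exp (- (real n * s))\<close> for arbitrarily large \<open>n\<close>, so the quotient is at
  most \<open>s\<close> infinitely often; this bounds the lower limit.\<close>

lemma AE_local_lower_entropy_at_le:
  assumes \<mu>: "\<mu> \<in> borel_prob_measures (Metric_space.mtopology (X 0) (d 0))"
    and KX: "K \<subseteq> X 0" and K: "AE x in \<mu>. x \<in> K" and zero: "bowen_outer X d T K s \<epsilon> = 0"
  shows "AE x in \<mu>. local_lower_entropy_at X d T \<mu> x (2 * \<epsilon>) \<le> ereal s"
proof -
  \<comment> \<open>Starting at \<open>Suc k\<close> excludes order 0, whose Bowen ball is
    unspecified.\<close>
  have "AE x in \<mu>. \<not> (x \<in> K \<and> (\<forall>n\<ge>Suc k. measure \<mu> (bowen_ball X d T n x (2 * \<epsilon>)) < exp (- (real n * s))))" for k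
  proof -
    obtain V where "V \<in> null_sets \<mu>"
      "{x\<in>K. \<forall>n\<ge>Suc k. measure \<mu> (bowen_ball X d T n x (2 * \<epsilon>)) < exp (- (real n * s))} \<subseteq> V"
      using null_cover_of_large_entropy[OF \<mu> KX zero zero_less_Suc] by blast
    then show ?thesis by (intro AE_I'[of V]) auto
  qed
  then have "AE x in \<mu>. \<forall>k. \<not> (x \<in> K \<and> (\<forall>n\<ge>Suc k. measure \<mu> (bowen_ball X d T n x (2 * \<epsilon>)) < exp (- (real n * s))))"
    by (subst AE_all_countable) simp
  with K show ?thesis
  proof eventually_elim
    case (elim x)
    show ?case
    proof (rule ccontr)
      assume "\<not> local_lower_entropy_at X d T \<mu> x (2 * \<epsilon>) \<le> ereal s"
      then have "\<forall>\<^sub>F n in sequentially.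
          ereal s < (- ereal_log (measure \<mu> (bowen_ball X d T n x (2 * \<epsilon>)))) / ereal (real n)"
        unfolding local_lower_entropy_at_def not_le by (rule less_LiminfD)
      then obtain k where k: "\<And>n. k \<le> n \<Longrightarrow>
          ereal s < (- ereal_log (measure \<mu> (bowen_ball X d T n x (2 * \<epsilon>)))) / ereal (real n)"
        by (auto simp: eventually_sequentially)
      obtain n where n: "Suc k \<le> n" "exp (- (real n * s)) \<le> measure \<mu> (bowen_ball X d T n x (2 * \<epsilon>))"
        using elim by (auto simp: not_less)
      define p where "p = measure \<mu> (bowen_ball X d T n x (2 * \<epsilon>))"
      have p: "0 < p" using n(2) exp_gt_zero[of "- (real n * s)"] unfolding p_def by linarith
      then have "ereal s < ereal (- ln p / real n)"
        using k[of n] n(1) by (simp add: p_def[symmetric] ereal_log_def)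
      then have "real n * s < - ln p" using n(1) by (simp add: field_simps)
      moreover have "- (real n * s) \<le> ln p"
        using n(2) p by (simp add: p_def[symmetric] ln_ge_iff)
      ultimately show False by linarith
    qed
  qed
qed

lemma bowen_entropy_at_le:
  assumes "0 < \<epsilon>" shows "bowen_entropy_at X d T Z \<epsilon> \<le> bowen_entropy X d T Z"
proof (rule tendsto_lowerbound[OF bowen_entropy_tendsto])
  have "\<forall>\<^sub>F e in at_right 0. e \<in> {0<..<\<epsilon>}" by (rule eventually_at_right_real[OF assms])
  then show "\<forall>\<^sub>F e in at_right 0. bowen_entropy_at X d T Z \<epsilon> \<le> bowen_entropy_at X d T Z e"
  proof (rule eventually_mono)
    fix e assume "e \<in> {0<..<\<epsilon>}"
    then have "bowen_outer X d T Z s \<epsilon> = 0" if "bowen_outer X d T Z s e = 0" for s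
      using bowen_outer_antimono[of e \<epsilon> X d T Z s] that by simp
    then show "bowen_entropy_at X d T Z \<epsilon> \<le> bowen_entropy_at X d T Z e"
      unfolding bowen_entropy_at_def by (intro Inf_superset_mono) blast
  qed
qed simp

text \<open>Along a sequence of scales only countably many exceptional null sets arise, and the
  limit at 0, which exists by monotonicity, can be computed along that sequence.\<close>

lemma lower_entropy_le:
  assumes \<mu>: "\<mu> \<in> borel_prob_measures (Metric_space.mtopology (X 0) (d 0))"
    and KX: "K \<subseteq> X 0" and K: "AE x in \<mu>. x \<in> K"
    and s: "0 \<le> s" "bowen_entropy X d T K < ereal s"
  shows "lower_entropy X d T \<mu> \<le> ereal s"
proof -
  interpret prob_space \<mu> using \<mu> by (simp add: borel_prob_measures_def)
  have sp: "space \<mu> = X 0"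
    using \<mu> by (simp add: borel_prob_measures_def Metric_space.topspace_mtopology[OF metric])
  define e where "e k = inverse (real (Suc k))" for k
  have e0: "0 < e k" "e k \<noteq> 0" for k by (simp_all add: e_def)
  have "AE x in \<mu>. local_lower_entropy_at X d T \<mu> x (2 * e k) \<le> ereal s" for k
  proof -
    have "bowen_entropy_at X d T K (e k) < ereal s"
      using bowen_entropy_at_le[OF e0(1)] s(2) by (rule le_less_trans)
    \<comment> \<open>Being an infimum, the entropy at this scale only provides some
      \<open>r < s\<close> with zero outer measure; the resulting bound by \<open>r\<close> is
      weakened to \<open>s\<close>.\<close>
    then obtain r where r: "r < s" "bowen_outer X d T K r (e k) = 0"
      unfolding bowen_entropy_at_def Inf_less_iff by auto
    show ?thesis
      using AE_local_lower_entropy_at_le[OF \<mu> KX K r(2)]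
      by eventually_elim (use r(1) in \<open>auto intro: order_trans\<close>)
  qed
  then have "AE x in \<mu>. \<forall>k. local_lower_entropy_at X d T \<mu> x (2 * e k) \<le> ereal s"
    by (subst AE_all_countable) simp
  then have "AE x in \<mu>. local_lower_entropy X d T \<mu> x \<le> ereal s"
    using AE_space
  proof eventually_elim
    case (elim x)
    have "(\<lambda>k. 2 * e k) \<longlonglongrightarrow> 2 * 0"
      unfolding e_def by (intro tendsto_mult tendsto_const LIMSEQ_inverse_real_of_nat)
    then have "filterlim (\<lambda>k. 2 * e k) (at_right 0) sequentially"
      using e0 by (auto simp: filterlim_at)
    then have "(\<lambda>k. local_lower_entropy_at X d T \<mu> x (2 * e k)) \<longlonglongrightarrow> local_lower_entropy X d T \<mu> x"
      using elim sp by (intro filterlim_compose[OF local_lower_entropy_tendsto[OF \<mu>]]) auto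
    then show ?case using elim by (intro LIMSEQ_le_const2) auto
  qed
  then have "(\<integral>\<^sup>+ x. e2ennreal (local_lower_entropy X d T \<mu> x) \<partial>\<mu>) \<le> (\<integral>\<^sup>+ x. e2ennreal (ereal s) \<partial>\<mu>)"
    by (intro nn_integral_mono_AE) (erule eventually_mono, rule e2ennreal_mono)
  also have "\<dots> = e2ennreal (ereal s)" by (simp add: emeasure_space_1)
  finally have "lower_entropy X d T \<mu> \<le> enn2ereal (e2ennreal (ereal s))"
    unfolding lower_entropy_def by (simp add: less_eq_ennreal.rep_eq)
  \<comment> \<open>Non-negativity of \<open>s\<close> makes the passage through
    \<open>ennreal\<close> exact; a negative value would come back as 0.\<close>
  then show ?thesis using s(1) by (simp add: enn2ereal_e2ennreal)
qed

text \<open>For negative \<open>s\<close> each term of a cover is at least 1, and a non-empty set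
  needs at least one ball. One fixed scale suffices, as the entropy at a scale never exceeds the
  limit.\<close>

lemma bowen_entropy_nonneg:
  assumes "K \<noteq> {}" shows "0 \<le> bowen_entropy X d T K"
proof -
  have "0 \<le> s" if zero: "bowen_outer X d T K s 1 = 0" for s
  proof (rule ccontr)
    assume s: "\<not> 0 \<le> s"
    have "bowen_outer_at X d T K s 1 0 \<le> bowen_outer X d T K s 1"
      unfolding bowen_outer_eq_SUP by (rule SUP_upper) simp
    then have "bowen_outer_at X d T K s 1 0 < 1" using zero by simp
    then obtain I c m where cov: "bowen_cover X d T 0 1 K I c m"
      and small: "(\<Sum>\<^sub>\<infinity>i\<in>I. ennreal (exp (- (real (m i) * s)))) < 1"
      unfolding bowen_outer_at_def Inf_less_iff by blast
    obtain i where i: "i \<in> I" using cov assms by (auto simp: bowen_cover_def)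
    have "ennreal (exp (- (real (m i) * s))) \<le> (\<Sum>\<^sub>\<infinity>i\<in>I. ennreal (exp (- (real (m i) * s))))"
      using sum_le_infsum_ennreal[of "{i}" I "\<lambda>i. ennreal (exp (- (real (m i) * s)))"] i by simp
    then have "ennreal (exp (- (real (m i) * s))) < 1" using small by (rule le_less_trans)
    moreover have "real (m i) * s \<le> 0" using s by (intro mult_nonneg_nonpos) auto
    ultimately show False by (simp add: ennreal_less_one_iff)
  qed
  then have "0 \<le> bowen_entropy_at X d T K 1"
    unfolding bowen_entropy_at_def by (intro Inf_greatest) auto
  also have "\<dots> \<le> bowen_entropy X d T K" by (rule bowen_entropy_at_le) simp
  finally show ?thesis .
qed

end

theorem corollary2p7:
  fixes X :: "nat \<Rightarrow> 'a set" and d :: "nat \<Rightarrow> 'a \<Rightarrow> 'a \<Rightarrow> real" and T :: "nat \<Rightarrow> 'a \<Rightarrow> 'a"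
    and K :: "'a set"
  assumes "nds X d T"
    and "K \<noteq> {}"
    and "compactin (Metric_space.mtopology (X 0) (d 0)) K"
  shows "bowen_entropy X d T K =
    Sup {lower_entropy X d T \<mu> | \<mu>.
      \<mu> \<in> borel_prob_measures (Metric_space.mtopology (X 0) (d 0)) \<and> measure \<mu> K = 1}"
proof -
  interpret nds X d T by (rule assms)
  let ?U = "Metric_space.mtopology (X 0) (d 0)"
  let ?H = "{lower_entropy X d T \<mu> | \<mu>. \<mu> \<in> borel_prob_measures ?U \<and> measure \<mu> K = 1}"
  have KX: "K \<subseteq> X 0"
    using compactin_subset_topspace[OF assms(3)] by (simp add: Metric_space.topspace_mtopology[OF metric])
  show ?thesis
  proof (rule antisym)
    show "bowen_entropy X d T K \<le> Sup ?H"
    proof (rule tendsto_upperbound[OF bowen_entropy_tendsto])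
      have "bowen_entropy_at X d T K e \<le> Sup ?H" if e: "0 < e" for e
      proof (rule dense_le)
        fix y assume "y < bowen_entropy_at X d T K e"
        \<comment> \<open>Approximation from below yields a real \<open>s\<close> strictly under the
          infimum that defines the entropy at scale \<open>e\<close>, so its outer measure is
          nonzero.\<close>
        then obtain s where s: "y < ereal s" "ereal s < bowen_entropy_at X d T K e"
          using ereal_dense3 by blast
        then have "bowen_outer X d T K s e \<noteq> 0"
          unfolding bowen_entropy_at_def using Inf_lower[of "ereal s"] by (auto simp: not_le[symmetric])
        then obtain \<mu> where "\<mu> \<in> borel_prob_measures ?U" "measure \<mu> K = 1" "ereal s \<le> lower_entropy X d T \<mu>"
          using exists_measure_lower_entropy_ge[OF assms(3) e] by blast
        then have "ereal s \<le> Sup ?H" by (intro Sup_upper2[of "lower_entropy X d T \<mu>"]) auto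
        with s(1) show "y \<le> Sup ?H" by (meson less_imp_le order_trans)
      qed
      then show "\<forall>\<^sub>F e in at_right 0. bowen_entropy_at X d T K e \<le> Sup ?H"
        by (auto simp: eventually_at_filter intro: always_eventually)
    qed simp
    show "Sup ?H \<le> bowen_entropy X d T K"
    proof (rule Sup_least, clarify)
      fix \<mu> assume \<mu>: "\<mu> \<in> borel_prob_measures ?U" and K1: "measure \<mu> K = 1"
      interpret prob_space \<mu> using \<mu> by (simp add: borel_prob_measures_def)
      have "AE x in \<mu>. x \<in> K"
        using K1 by (intro AE_prob_1)
      show "lower_entropy X d T \<mu> \<le> bowen_entropy X d T K"
      proof (rule dense_ge)
        fix y assume "bowen_entropy X d T K < y"
        \<comment> \<open>Approximation from above yields a real \<open>s\<close> beyond the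
          entropy, as the upper estimate requires; it is non-negative because \<open>K\<close> is
          non-empty.\<close>
        then obtain s where s: "bowen_entropy X d T K < ereal s" "ereal s < y"
          using ereal_dense3 by blast
        have "0 \<le> s" using bowen_entropy_nonneg[OF assms(2)] s(1)
          by (metis ereal_less_eq(5) less_imp_le order_trans)
        from lower_entropy_le[OF \<mu> KX \<open>AE x in \<mu>. x \<in> K\<close> this s(1)] s(2)
        show "lower_entropy X d T \<mu> \<le> y" by (meson less_imp_le order_trans)
      qed
    qed
  qed
qed

end
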